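(* Let $(X,\mathcal{A})$ be a measurable space and let $S(X,\mathcal{A})$ be a $\chi$-ring. Let $\mathcal{M}_S$ be the set of all maximal ideals of $S(X,\mathcal{A})$ with the topology $\tau_\chi$, and let $\mathcal{U}_X$ be the set of all $\mathcal{A}$-ultrafilters on $X$ with the Stone topology $\tau$. Then $S(X,\mathcal{A})$ is Gelfand if and only if the map $\mathcal{Z}_S^\chi:(\mathcal{M}_S,\tau_\chi)\to(\mathcal{U}_X,\tau)$, $M\mapsto\mathcal{Z}_S[M]$, is a homeomorphism.
   Context: A measurable space $(X,\mathcal{A})$ is a nonempty set $X$ with a $\sigma$-algebra $\mathcal{A}$ of subsets of $X$. $\mathcal{M}(X,\mathcal{A})$ is the commutative ring (pointwise operations) of all $\mathcal{A}$-measurable functions $X\to\mathbb{R}$. A $\chi$-ring $S(X,\mathcal{A})$ is a subring of $\mathcal{M}(X,\mathcal{A})$ such that $\chi_A\in S(X,\mathcal{A})$ for every $A\in\mathcal{A}$, where $\chi_A$ is the characteristic function of $A$. For $f\in S(X,\mathcal{A})$, $\mathcal{Z}_S(f)=\{E\in\mathcal{A}: \text{there exists } g\in S(X,\mathcal{A}) \text{ with } f(x)g(x)=1 \text{ for all } x\in X\setminus E\}$; for a proper ideal $I$, $\mathcal{Z}_S[I]=\bigcup_{f\in I}\mathcal{Z}_S(f)$. An $\mathcal{A}$-filter on $X$ is a nonempty family of members of $\mathcal{A}$ not containing $\emptyset$, closed under finite intersections and under supersets belonging to $\mathcal{A}$; an $\mathcal{A}$-ultrafilter is a maximal $\mathcal{A}$-filter.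 For every maximal ideal $M$, $\mathcal{Z}_S[M]$ is an $\mathcal{A}$-ultrafilter. The topology $\tau_\chi$ on $\mathcal{M}_S$ is the one having as a base for closed sets the sets $\mathcal{M}_{\chi_E}=\{M\in\mathcal{M}_S:\chi_E\in M\}$, $E\in\mathcal{A}$. The Stone topology $\tau$ on $\mathcal{U}_X$ has as a base for closed sets the sets $S_E=\{\mathcal{U}\in\mathcal{U}_X: E\in\mathcal{U}\}$, $E\in\mathcal{A}$. A commutative ring with unity is Gelfand if every (proper) prime ideal is contained in a unique maximal ideal. *)

theory Defs
  imports "HOL-Analysis.Analysis" "HOL-Algebra.Subrings"
begin

text \<open>Real functions on \<open>X\<close> are represented by the functions that are \<open>undefined\<close> outside \<open>X\<close>,
  so that equality of ring elements is equality on \<open>X\<close>.\<close>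

definition measurable_fun_ring :: "'a set \<Rightarrow> 'a set set \<Rightarrow> ('a \<Rightarrow> real) ring" where
  "measurable_fun_ring X \<A> =
    \<lparr>carrier = borel_measurable (sigma X \<A>) \<inter> extensional X,
     mult = (\<lambda>f g. \<lambda>x\<in>X. f x * g x),
     one = (\<lambda>x\<in>X. 1),
     zero = (\<lambda>x\<in>X. 0),
     add = (\<lambda>f g. \<lambda>x\<in>X. f x + g x)\<rparr>"

definition chi :: "'a set \<Rightarrow> 'a set \<Rightarrow> 'a \<Rightarrow> real" where
  "chi X E = (\<lambda>x\<in>X. indicator E x)"

definition chi_ring :: "'a set \<Rightarrow> 'a set set \<Rightarrow> ('a \<Rightarrow> real) set \<Rightarrow> bool" where
  "chi_ring X \<A> S \<longleftrightarrow> subring S (measurable_fun_ring X \<A>) \<and> (\<forall>E\<in>\<A>. chi X E \<in> S)"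

definition fun_ring_on :: "'a set \<Rightarrow> 'a set set \<Rightarrow> ('a \<Rightarrow> real) set \<Rightarrow> ('a \<Rightarrow> real) ring" where
  "fun_ring_on X \<A> S = (measurable_fun_ring X \<A>)\<lparr>carrier := S\<rparr>"

definition Z_fun :: "'a set \<Rightarrow> 'a set set \<Rightarrow> ('a \<Rightarrow> real) set \<Rightarrow> ('a \<Rightarrow> real) \<Rightarrow> 'a set set" where
  "Z_fun X \<A> S f = {E \<in> \<A>. \<exists>g\<in>S. \<forall>x\<in>X - E. f x * g x = 1}"

definition Z_ideal :: "'a set \<Rightarrow> 'a set set \<Rightarrow> ('a \<Rightarrow> real) set \<Rightarrow> ('a \<Rightarrow> real) set \<Rightarrow> 'a set set" where
  "Z_ideal X \<A> S I = (\<Union>f\<in>I. Z_fun X \<A> S f)"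

definition A_filter :: "'a set set \<Rightarrow> 'a set set \<Rightarrow> bool" where
  "A_filter \<A> \<F> \<longleftrightarrow> \<F> \<noteq> {} \<and> \<F> \<subseteq> \<A> \<and> {} \<notin> \<F> \<and>
    (\<forall>E\<in>\<F>. \<forall>F\<in>\<F>. E \<inter> F \<in> \<F>) \<and> (\<forall>E\<in>\<F>. \<forall>F\<in>\<A>. E \<subseteq> F \<longrightarrow> F \<in> \<F>)"

definition A_ultrafilter :: "'a set set \<Rightarrow> 'a set set \<Rightarrow> bool" where
  "A_ultrafilter \<A> \<U> \<longleftrightarrow> A_filter \<A> \<U> \<and> (\<forall>\<F>. A_filter \<A> \<F> \<and> \<U> \<subseteq> \<F> \<longrightarrow> \<F> = \<U>)"

definition gelfand :: "('r, 'm) ring_scheme \<Rightarrow> bool" where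
  "gelfand R \<longleftrightarrow> cring R \<and> (\<forall>P. primeideal P R \<longrightarrow> (\<exists>!M. maximalideal M R \<and> P \<subseteq> M))"

text \<open>The topology on \<open>U\<close> whose closed sets are the intersections of subfamilies of \<open>\<B>\<close>
  (the empty intersection being \<open>U\<close>). This is a topology only if \<open>\<B>\<close> really is a base for
  closed sets; \<open>closedin_closed_base\<close> below gives a sufficient condition, which
  is then verified for the two spaces of interest.\<close>

definition closed_base_topology :: "'b set \<Rightarrow> 'b set set \<Rightarrow> 'b topology" where
  "closed_base_topology U \<B> = topology (\<lambda>V. V \<subseteq> U \<and> (\<exists>\<C>\<subseteq>\<B>. U - V = U \<inter> \<Inter>\<C>))"

definition max_ideals :: "('r, 'm) ring_scheme \<Rightarrow> 'r set set" where
  "max_ideals R = {M. maximalideal M R}"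

definition tau_chi :: "'a set \<Rightarrow> 'a set set \<Rightarrow> ('a \<Rightarrow> real) set \<Rightarrow> ('a \<Rightarrow> real) set topology" where
  "tau_chi X \<A> S = closed_base_topology (max_ideals (fun_ring_on X \<A> S))
     ((\<lambda>E. {M \<in> max_ideals (fun_ring_on X \<A> S). chi X E \<in> M}) ` \<A>)"

definition stone_topology :: "'a set set \<Rightarrow> 'a set set topology" where
  "stone_topology \<A> = closed_base_topology {\<U>. A_ultrafilter \<A> \<U>}
     ((\<lambda>E. {\<U>. A_ultrafilter \<A> \<U> \<and> E \<in> \<U>}) ` \<A>)"

lemma
  assumes empty: "{} \<in> \<B>" and Un: "\<And>C D. C \<in> \<B> \<Longrightarrow> D \<in> \<B> \<Longrightarrow> C \<union> D \<in> \<B>"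
  shows topspace_closed_base: "topspace (closed_base_topology U \<B>) = U"
    and closedin_closed_base:
      "closedin (closed_base_topology U \<B>) K \<longleftrightarrow> (\<exists>\<C>\<subseteq>\<B>. K = U \<inter> \<Inter>\<C>)"
proof -
  let ?P = "\<lambda>V. V \<subseteq> U \<and> (\<exists>\<C>\<subseteq>\<B>. U - V = U \<inter> \<Inter>\<C>)"
  have "istopology ?P"
    unfolding istopology_def
  proof (intro conjI allI impI)
    fix V W assume V: "?P V" and W: "?P W"
    then obtain C D where C: "C \<subseteq> \<B>" "U - V = U \<inter> \<Inter>C" and D: "D \<subseteq> \<B>" "U - W = U \<inter> \<Inter>D"
      by blast
    have "U - V \<inter> W = (U - V) \<union> (U - W)" by blast
    also have "\<dots> = U \<inter> \<Inter>{c \<union> d |c d. c \<in> C \<and> d \<in> D}" unfolding C D by blast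
    finally have "U - V \<inter> W = U \<inter> \<Inter>{c \<union> d |c d. c \<in> C \<and> d \<in> D}" .
    moreover have "{c \<union> d |c d. c \<in> C \<and> d \<in> D} \<subseteq> \<B>" using C D Un by blast
    ultimately show "\<exists>\<C>\<subseteq>\<B>. U - V \<inter> W = U \<inter> \<Inter>\<C>" by blast
    show "V \<inter> W \<subseteq> U" using V by blast
  next
    fix K assume K: "\<forall>V\<in>K. ?P V"
    then have "\<forall>V\<in>K. \<exists>D. D \<subseteq> \<B> \<and> U - V = U \<inter> \<Inter>D" by blast
    then obtain C where C: "\<forall>V\<in>K. C V \<subseteq> \<B> \<and> U - V = U \<inter> \<Inter>(C V)"
      by (rule bchoice[THEN exE])
    have "U - \<Union>K = U \<inter> (\<Inter>V\<in>K. U - V)" by blast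
    also have "\<dots> = U \<inter> (\<Inter>V\<in>K. U \<inter> \<Inter>(C V))" using C by simp
    also have "\<dots> = U \<inter> \<Inter>(\<Union>V\<in>K. C V)" by blast
    finally have "U - \<Union>K = U \<inter> \<Inter>(\<Union>V\<in>K. C V)" .
    moreover have "(\<Union>V\<in>K. C V) \<subseteq> \<B>" using C by blast
    ultimately show "\<exists>\<C>\<subseteq>\<B>. U - \<Union>K = U \<inter> \<Inter>\<C>" by blast
    show "\<Union>K \<subseteq> U" using K by blast
  qed
  then have o: "openin (closed_base_topology U \<B>) = ?P"
    by (simp add: closed_base_topology_def topology_inverse')
  have "?P U" using empty by (intro conjI exI[of _ "{{}}"]) auto
  then have "openin (closed_base_topology U \<B>) U" unfolding o .
  moreover have "topspace (closed_base_topology U \<B>) \<subseteq> U" unfolding topspace_def o by blast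
  ultimately have top: "topspace (closed_base_topology U \<B>) = U"
    by (meson openin_subset subset_antisym)
  then show "topspace (closed_base_topology U \<B>) = U" .
  show "closedin (closed_base_topology U \<B>) K \<longleftrightarrow> (\<exists>\<C>\<subseteq>\<B>. K = U \<inter> \<Inter>\<C>)"
  proof (cases "K \<subseteq> U")
    case True
    then have "U - (U - K) = K" by blast
    with True show ?thesis unfolding closedin_def top o by simp
  next
    case False
    then show ?thesis unfolding closedin_def top by blast
  qed
qed

lemma cring_measurable_fun_ring: "cring (measurable_fun_ring X \<A>)"
proof -
  let ?B = "borel_measurable (sigma X \<A>)"
  have restr: "restrict f X \<in> ?B" if "f \<in> ?B" for f :: "'a \<Rightarrow> real"
    using that by (subst measurable_cong[where g = f]) (simp_all add: space_measure_of_conv)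
  have [simp]: "(\<lambda>x\<in>X. f x + g x) \<in> ?B" "(\<lambda>x\<in>X. f x * g x) \<in> ?B"
    if "f \<in> ?B" "g \<in> ?B" for f g :: "'a \<Rightarrow> real"
    using that by (simp_all add: restr)
  have [simp]: "(\<lambda>x\<in>X. - f x) \<in> ?B" if "f \<in> ?B" for f :: "'a \<Rightarrow> real"
    using that by (simp add: restr)
  have [simp]: "(\<lambda>x\<in>X. c) \<in> ?B" for c :: real by (rule restr) simp
  have [simp]: "restrict f X = f" if "f \<in> extensional X" for f :: "'a \<Rightarrow> real"
    using that by (rule extensional_restrict)
  show ?thesis
  proof (rule cringI)
    show "abelian_group (measurable_fun_ring X \<A>)"
    proof (rule abelian_groupI)
      fix f assume f: "f \<in> carrier (measurable_fun_ring X \<A>)"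
      then show "\<exists>g\<in>carrier (measurable_fun_ring X \<A>).
          g \<oplus>\<^bsub>measurable_fun_ring X \<A>\<^esub> f = \<zero>\<^bsub>measurable_fun_ring X \<A>\<^esub>"
        by (intro bexI[of _ "\<lambda>x\<in>X. - f x"]) (auto simp: measurable_fun_ring_def)
    qed (auto simp: measurable_fun_ring_def algebra_simps cong: restrict_cong)
    show "Group.comm_monoid (measurable_fun_ring X \<A>)"
      by unfold_locales
        (auto simp: measurable_fun_ring_def algebra_simps cong: restrict_cong)
  qed (auto simp: measurable_fun_ring_def algebra_simps cong: restrict_cong)
qed

lemma cring_fun_ring_on:
  assumes "chi_ring X \<A> S"
  shows "cring (fun_ring_on X \<A> S)"
proof -
  interpret cring "measurable_fun_ring X \<A>" by (rule cring_measurable_fun_ring)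
  have S: "subring S (measurable_fun_ring X \<A>)" using assms by (simp add: chi_ring_def)
  then have "subcring S (measurable_fun_ring X \<A>)"
    by (rule subcringI')
  then show ?thesis
    unfolding fun_ring_on_def using S subringE(1) subcring_iff by blast
qed

lemma ex_family_image: "(\<exists>\<C>\<subseteq>f ` A. P \<C>) \<longleftrightarrow> (\<exists>E\<subseteq>A. P (f ` E))"
  unfolding subset_image_iff by blast

lemma tau_chi_base:
  assumes "sigma_algebra X \<A>" "chi_ring X \<A> S"
  shows "topspace (tau_chi X \<A> S) = max_ideals (fun_ring_on X \<A> S)"
    and "closedin (tau_chi X \<A> S) K \<longleftrightarrow>
      (\<exists>\<E>\<subseteq>\<A>. K = {M \<in> max_ideals (fun_ring_on X \<A> S). \<forall>E\<in>\<E>. chi X E \<in> M})"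
proof -
  let ?R = "fun_ring_on X \<A> S"
  let ?b = "\<lambda>E. {M \<in> max_ideals ?R. chi X E \<in> M}"
  interpret sigma_algebra X \<A> by fact
  interpret R: cring ?R using assms(2) by (rule cring_fun_ring_on)
  have chi: "chi X E \<in> carrier ?R" if "E \<in> \<A>" for E
    using assms(2) that by (simp add: chi_ring_def fun_ring_on_def)
  have one: "chi X X = \<one>\<^bsub>?R\<^esub>"
    by (auto simp: chi_def fun_ring_on_def measurable_fun_ring_def fun_eq_iff)
  have "?b X = {}"
    using one ideal.one_imp_carrier maximalideal.I_notcarr maximalideal.axioms(1)
    unfolding max_ideals_def by (metis (no_types, lifting) Collect_empty_eq mem_Collect_eq)
  then have empty: "{} \<in> ?b ` \<A>" using top by (intro image_eqI[where x = X]) simp_all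
  have un: "?b E \<union> ?b F = ?b (E \<inter> F)" if EF: "E \<in> \<A>" "F \<in> \<A>" for E F
  proof -
    have eq: "chi X (E \<inter> F) = chi X E \<otimes>\<^bsub>?R\<^esub> chi X F"
      by (auto simp: chi_def fun_ring_on_def measurable_fun_ring_def fun_eq_iff indicator_def)
    have "chi X (E \<inter> F) \<in> M \<longleftrightarrow> chi X E \<in> M \<or> chi X F \<in> M" if M: "maximalideal M ?R" for M
    proof -
      interpret primeideal M ?R using M by (rule R.maximalideal_prime)
      show ?thesis
        unfolding eq using I_prime[of "chi X E" "chi X F"] I_l_closed[of "chi X F" "chi X E"]
          I_r_closed[of "chi X E" "chi X F"] chi[OF EF(1)] chi[OF EF(2)] by metis
    qed
    then show ?thesis by (auto simp: max_ideals_def)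
  qed
  have Un: "C \<union> D \<in> ?b ` \<A>" if CD: "C \<in> ?b ` \<A>" "D \<in> ?b ` \<A>" for C D
  proof -
    obtain E F where "E \<in> \<A>" "C = ?b E" "F \<in> \<A>" "D = ?b F" using CD by blast
    then show ?thesis using un[of E F] Int[of E F] by (intro image_eqI[where x = "E \<inter> F"]) simp_all
  qed
  show "topspace (tau_chi X \<A> S) = max_ideals ?R"
    unfolding tau_chi_def using empty Un by (rule topspace_closed_base)
  have "closedin (tau_chi X \<A> S) K \<longleftrightarrow> (\<exists>\<C>\<subseteq>?b ` \<A>. K = max_ideals ?R \<inter> \<Inter>\<C>)"
    unfolding tau_chi_def using empty Un by (rule closedin_closed_base)
  also have "\<dots> \<longleftrightarrow> (\<exists>\<E>\<subseteq>\<A>. K = max_ideals ?R \<inter> \<Inter>(?b ` \<E>))"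
    by (rule ex_family_image)
  also have "\<dots> \<longleftrightarrow> (\<exists>\<E>\<subseteq>\<A>. K = {M \<in> max_ideals ?R. \<forall>E\<in>\<E>. chi X E \<in> M})"
  proof -
    have "max_ideals ?R \<inter> \<Inter>(?b ` \<E>) = {M \<in> max_ideals ?R. \<forall>E\<in>\<E>. chi X E \<in> M}" for \<E>
      by auto
    then show ?thesis by simp
  qed
  finally show "closedin (tau_chi X \<A> S) K \<longleftrightarrow>
      (\<exists>\<E>\<subseteq>\<A>. K = {M \<in> max_ideals ?R. \<forall>E\<in>\<E>. chi X E \<in> M})" .
qed

lemma A_ultrafilter_Un:
  assumes A: "sigma_algebra X \<A>" and U: "A_ultrafilter \<A> \<U>" and EF: "E \<in> \<A>" "F \<in> \<A>"
  shows "E \<union> F \<in> \<U> \<longleftrightarrow> E \<in> \<U> \<or> F \<in> \<U>"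
proof
  interpret sigma_algebra X \<A> by fact
  have fil: "A_filter \<A> \<U>" using U by (simp add: A_ultrafilter_def)
  show "E \<in> \<U> \<or> F \<in> \<U> \<Longrightarrow> E \<union> F \<in> \<U>"
    using fil EF Un[OF EF] unfolding A_filter_def by (metis Un_upper1 Un_upper2)
  assume EFU: "E \<union> F \<in> \<U>"
  show "E \<in> \<U> \<or> F \<in> \<U>"
  proof (rule ccontr)
    assume n: "\<not> (E \<in> \<U> \<or> F \<in> \<U>)"
    let ?G = "{H \<in> \<A>. \<exists>V\<in>\<U>. V \<inter> E \<subseteq> H}"
    have sub: "\<U> \<subseteq> ?G" using fil unfolding A_filter_def by blast
    have "{} \<notin> ?G"
    proof
      assume "{} \<in> ?G"
      then obtain V where V: "V \<in> \<U>" "V \<inter> E = {}" by blast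
      then have "V \<inter> (E \<union> F) \<in> \<U>" "V \<inter> (E \<union> F) \<subseteq> F" using fil EFU unfolding A_filter_def by blast+
      then have "F \<in> \<U>" using fil EF unfolding A_filter_def by blast
      with n show False by blast
    qed
    moreover have "H \<inter> K \<in> ?G" if HK: "H \<in> ?G" "K \<in> ?G" for H K
    proof -
      from HK obtain V W where VW: "V \<in> \<U>" "W \<in> \<U>" "V \<inter> E \<subseteq> H" "W \<inter> E \<subseteq> K" by blast
      have "V \<inter> W \<in> \<U>" using VW fil unfolding A_filter_def by blast
      moreover have "V \<inter> W \<inter> E \<subseteq> H \<inter> K" using VW by blast
      ultimately show ?thesis using HK by blast
    qed
    moreover have "?G \<noteq> {}" using sub fil unfolding A_filter_def by blast
    moreover have "K \<in> ?G" if "H \<in> ?G" "K \<in> \<A>" "H \<subseteq> K" for H K using that by blast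
    moreover have "?G \<subseteq> \<A>" by blast
    ultimately have "A_filter \<A> ?G" unfolding A_filter_def by (intro conjI ballI impI)
    then have "?G = \<U>" using U sub unfolding A_ultrafilter_def by blast
    moreover have "E \<in> ?G" using EF EFU by blast
    ultimately show False using n by blast
  qed
qed

lemma stone_topology_base:
  assumes "sigma_algebra X \<A>"
  shows "topspace (stone_topology \<A>) = {\<U>. A_ultrafilter \<A> \<U>}"
    and "closedin (stone_topology \<A>) K \<longleftrightarrow>
      (\<exists>\<E>\<subseteq>\<A>. K = {\<U>. A_ultrafilter \<A> \<U> \<and> \<E> \<subseteq> \<U>})"
proof -
  let ?b = "\<lambda>E. {\<U>. A_ultrafilter \<A> \<U> \<and> E \<in> \<U>}"
  interpret sigma_algebra X \<A> by fact
  have "?b {} = {}" by (auto simp: A_ultrafilter_def A_filter_def)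
  then have empty: "{} \<in> ?b ` \<A>" using empty_sets by (intro image_eqI[where x = "{}"]) simp_all
  have un: "?b E \<union> ?b F = ?b (E \<union> F)" if "E \<in> \<A>" "F \<in> \<A>" for E F
    using A_ultrafilter_Un[OF assms _ that] by blast
  have Un: "C \<union> D \<in> ?b ` \<A>" if CD: "C \<in> ?b ` \<A>" "D \<in> ?b ` \<A>" for C D
  proof -
    obtain E F where "E \<in> \<A>" "C = ?b E" "F \<in> \<A>" "D = ?b F" using CD by blast
    then show ?thesis using un[of E F] Un[of E F] by (intro image_eqI[where x = "E \<union> F"]) simp_all
  qed
  show "topspace (stone_topology \<A>) = {\<U>. A_ultrafilter \<A> \<U>}"
    unfolding stone_topology_def using empty Un by (rule topspace_closed_base)
  have "closedin (stone_topology \<A>) K \<longleftrightarrow> (\<exists>\<C>\<subseteq>?b ` \<A>. K = {\<U>. A_ultrafilter \<A> \<U>} \<inter> \<Inter>\<C>)"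
    unfolding stone_topology_def using empty Un by (rule closedin_closed_base)
  also have "\<dots> \<longleftrightarrow> (\<exists>\<E>\<subseteq>\<A>. K = {\<U>. A_ultrafilter \<A> \<U>} \<inter> \<Inter>(?b ` \<E>))"
    by (rule ex_family_image)
  also have "\<dots> \<longleftrightarrow> (\<exists>\<E>\<subseteq>\<A>. K = {\<U>. A_ultrafilter \<A> \<U> \<and> \<E> \<subseteq> \<U>})"
  proof -
    have "{\<U>. A_ultrafilter \<A> \<U>} \<inter> \<Inter>(?b ` \<E>) = {\<U>. A_ultrafilter \<A> \<U> \<and> \<E> \<subseteq> \<U>}" for \<E>
      by auto
    then show ?thesis by simp
  qed
  finally show "closedin (stone_topology \<A>) K \<longleftrightarrow>
      (\<exists>\<E>\<subseteq>\<A>. K = {\<U>. A_ultrafilter \<A> \<U> \<and> \<E> \<subseteq> \<U>})" .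
qed

end

theory Submission
  imports Defs "HOL-Algebra.Ring_Divisibility"
begin

text \<open>
  For a prime ideal \<open>P\<close> one has \<open>E \<in> \<Z>\<^sub>S[P]\<close> iff \<open>\<chi>\<^sub>E \<notin> P\<close>, so \<open>\<Z>\<^sub>S\<close> is monotone and even constant
  along inclusions of prime ideals, and it matches the bases of the two topologies. Conversely, an
  ultrafilter \<open>\<U>\<close> defines the ideal \<open>I\<close> of those \<open>f \<in> S\<close> whose zero set lies in \<open>\<U>\<close>; it is prime,
  because the zero set of a product is the union of the zero sets, and it is contained in every
  maximal ideal \<open>M\<close> with \<open>\<Z>\<^sub>S[M] = \<U>\<close>, because \<open>f = f \<chi>\<^sub>E\<close> for the cozero set \<open>E\<close> of \<open>f\<close>. Hence
  \<open>\<Z>\<^sub>S\<close> is always onto, it is injective iff \<open>S\<close> is Gelfand, and a bijection that matches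
  the bases is a homeomorphism.
\<close>

text \<open>Zorn's lemma on the ideals that contain \<open>I\<close> and avoid \<one>: the union of
  a nonempty chain of them avoids \<one> too, and an ideal that contains \<one> is the whole
  ring.\<close>

lemma (in ring) ex_maximalideal:
  assumes "ideal I R" "\<one> \<notin> I"
  obtains M where "maximalideal M R" "I \<subseteq> M"
proof -
  let ?A = "{J. ideal J R \<and> I \<subseteq> J \<and> \<one> \<notin> J}"
  have "\<exists>M\<in>?A. \<forall>J\<in>?A. M \<subseteq> J \<longrightarrow> J = M"
  proof (rule subset_Zorn_nonempty)
    show "?A \<noteq> {}" using assms by blast
    fix C assume C: "C \<noteq> {}" "subset.chain ?A C"
    then have "subset.chain {I. ideal I R} C" by (auto simp: pred_on.chain_def)
    then have "ideal (\<Union>C) R" using C(1) chain_Union_is_ideal[of C] by simp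
    then show "\<Union>C \<in> ?A" using C by (auto simp: pred_on.chain_def)
  qed
  then obtain M where M: "ideal M R" "I \<subseteq> M" "\<one> \<notin> M"
    and max: "\<And>J. ideal J R \<Longrightarrow> I \<subseteq> J \<Longrightarrow> \<one> \<notin> J \<Longrightarrow> M \<subseteq> J \<Longrightarrow> J = M"
    by auto
  have "maximalideal M R"
    using M max ideal.one_imp_carrier by (intro maximalidealI) blast+
  with M(2) that show thesis by blast
qed

section \<open>Pointwise arithmetic and zero sets in \<open>S\<close>\<close>

locale chi_ring_space = sigma_algebra X \<A> for X :: "'a set" and \<A> +
  fixes S :: "('a \<Rightarrow> real) set"
  assumes chi_ring: "chi_ring X \<A> S"
begin

abbreviation "R \<equiv> fun_ring_on X \<A> S"

sublocale R: cring R
  using chi_ring by (rule cring_fun_ring_on)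

lemma fun_ring_on_simps [simp]:
  "carrier R = S"
  "f \<otimes>\<^bsub>R\<^esub> g = (\<lambda>x\<in>X. f x * g x)"
  "f \<oplus>\<^bsub>R\<^esub> g = (\<lambda>x\<in>X. f x + g x)"
  "\<one>\<^bsub>R\<^esub> = (\<lambda>x\<in>X. 1)"
  "\<zero>\<^bsub>R\<^esub> = (\<lambda>x\<in>X. 0)"
  by (simp_all add: fun_ring_on_def measurable_fun_ring_def)

lemma S_subset: "S \<subseteq> borel_measurable (sigma X \<A>) \<inter> extensional X"
  using chi_ring subringE(1)[of S "measurable_fun_ring X \<A>"]
  by (simp add: chi_ring_def measurable_fun_ring_def)

lemma chi_closed: "E \<in> \<A> \<Longrightarrow> chi X E \<in> S"
  using chi_ring by (simp add: chi_ring_def)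

lemma zero_set_sets:
  assumes "f \<in> S"
  shows "{x \<in> X. f x = 0} \<in> \<A>"
proof -
  have "f \<in> borel_measurable (sigma X \<A>)" using assms S_subset by blast
  then have "f -` {0} \<inter> space (sigma X \<A>) \<in> sets (sigma X \<A>)"
    by (rule measurable_sets) simp
  moreover have "f -` {0} \<inter> X = {x \<in> X. f x = 0}" by blast
  ultimately show ?thesis by (simp add: space_closed space_measure_of_conv)
qed

section \<open>From prime ideals to ultrafilters\<close>

text \<open>The two characteristic functions have product 0 and sum 1: primality puts one of them
  into \<open>P\<close>, properness keeps the other out.\<close>

lemma prime_chi_iff:
  assumes "primeideal P R" "E \<in> \<A>"
  shows "chi X E \<in> P \<longleftrightarrow> chi X (X - E) \<notin> P"
proof -
  interpret P: primeideal P R by fact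
  have E: "chi X E \<in> S" "chi X (X - E) \<in> S" using assms(2) by (simp_all add: chi_closed compl_sets)
  have "chi X E \<otimes>\<^bsub>R\<^esub> chi X (X - E) = \<zero>\<^bsub>R\<^esub>" "chi X E \<oplus>\<^bsub>R\<^esub> chi X (X - E) = \<one>\<^bsub>R\<^esub>"
    by (auto simp: chi_def indicator_def)
  then show ?thesis
    using P.I_prime[of "chi X E" "chi X (X - E)"] P.a_closed[of "chi X E" "chi X (X - E)"]
      P.one_imp_carrier P.I_notcarr P.zero_closed E
    by (metis fun_ring_on_simps(1))
qed

text \<open>If \<open>g\<close> inverts \<open>f\<close> off \<open>E\<close>, multiplying
  \<open>f g\<close> by \<open>chi X (X - E)\<close> discards the unknown values on
  \<open>E\<close>. Conversely \<open>chi X (X - E)\<close> is its own witness, with inverse 1 off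
  \<open>E\<close>.\<close>

lemma Z_ideal_iff_chi_compl:
  assumes "ideal I R"
  shows "E \<in> Z_ideal X \<A> S I \<longleftrightarrow> E \<in> \<A> \<and> chi X (X - E) \<in> I"
proof
  interpret I: ideal I R by fact
  {
    assume "E \<in> Z_ideal X \<A> S I"
    then obtain f g where E: "E \<in> \<A>" and f: "f \<in> I" and g: "g \<in> S" "\<forall>x\<in>X - E. f x * g x = 1"
      by (auto simp: Z_ideal_def Z_fun_def)
    have "(f \<otimes>\<^bsub>R\<^esub> g) \<otimes>\<^bsub>R\<^esub> chi X (X - E) \<in> I"
      using f g(1) E by (intro I.I_r_closed) (simp_all add: chi_closed compl_sets)
    also have "(f \<otimes>\<^bsub>R\<^esub> g) \<otimes>\<^bsub>R\<^esub> chi X (X - E) = chi X (X - E)"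
      using g(2) by (auto simp: chi_def indicator_def intro!: restrict_ext)
    finally show "E \<in> \<A> \<and> chi X (X - E) \<in> I" using E by blast
  }
  assume "E \<in> \<A> \<and> chi X (X - E) \<in> I"
  \<comment> \<open>\<open>chi X X\<close> is the constant 1, the local inverse required by
    \<open>Z_fun\<close>.\<close>
  moreover have "chi X X \<in> S" by (simp add: chi_closed)
  moreover have "\<forall>x\<in>X - E. chi X (X - E) x * chi X X x = 1" by (simp add: chi_def)
  ultimately show "E \<in> Z_ideal X \<A> S I" unfolding Z_ideal_def Z_fun_def by blast
qed

lemma Z_ideal_prime:
  assumes "primeideal P R"
  shows "Z_ideal X \<A> S P = {E \<in> \<A>. chi X E \<notin> P}"
  using Z_ideal_iff_chi_compl[OF primeideal.axioms(1)[OF assms]] prime_chi_iff[OF assms] by blast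

text \<open>\<open>Z_ideal\<close> is monotone by definition, but its description for primes by
  \<open>chi X E \<notin> P\<close> is antitone, so both inclusions hold.\<close>

lemma Z_ideal_prime_mono_eq:
  assumes "primeideal P R" "primeideal Q R" "P \<subseteq> Q"
  shows "Z_ideal X \<A> S P = Z_ideal X \<A> S Q"
proof
  show "Z_ideal X \<A> S P \<subseteq> Z_ideal X \<A> S Q" using assms(3) by (auto simp: Z_ideal_def)
  show "Z_ideal X \<A> S Q \<subseteq> Z_ideal X \<A> S P"
    using assms by (auto simp: Z_ideal_prime)
qed

text \<open>Since \<chi> turns intersections into products, primality gives closure under
  intersections and the ideal property gives upward closure.\<close>

lemma A_ultrafilter_Z_ideal:
  assumes "primeideal P R"
  shows "A_ultrafilter \<A> (Z_ideal X \<A> S P)"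
proof -
  interpret P: primeideal P R by fact
  note Z = Z_ideal_prime[OF assms]
  have zero: "chi X {} = \<zero>\<^bsub>R\<^esub>" and one: "chi X X = \<one>\<^bsub>R\<^esub>"
    by (auto simp: chi_def)
  have mult: "chi X (E \<inter> F) = chi X E \<otimes>\<^bsub>R\<^esub> chi X F" for E F
    by (auto simp: chi_def indicator_def)
  have mem: "chi X F \<notin> P" if "chi X E \<notin> P" "E \<subseteq> F" "E \<in> \<A>" for E F
    using that P.I_l_closed[of "chi X F" "chi X E"] mult[of E F] chi_closed[of E]
    by (metis inf.absorb1 fun_ring_on_simps(1))
  have "{} \<notin> Z_ideal X \<A> S P" unfolding Z using zero P.zero_closed by simp
  moreover have "X \<in> Z_ideal X \<A> S P"
    unfolding Z using one P.one_imp_carrier P.I_notcarr by auto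
  moreover have "E \<inter> F \<in> Z_ideal X \<A> S P"
    if "E \<in> Z_ideal X \<A> S P" "F \<in> Z_ideal X \<A> S P" for E F
    using that P.I_prime[of "chi X E" "chi X F"] mult[of E F] chi_closed unfolding Z by auto
  ultimately have fil: "A_filter \<A> (Z_ideal X \<A> S P)"
    unfolding A_filter_def using mem by (auto simp: Z)
  have "\<F> \<subseteq> Z_ideal X \<A> S P" if F: "A_filter \<A> \<F>" "Z_ideal X \<A> S P \<subseteq> \<F>" for \<F>
  proof
    fix E assume E: "E \<in> \<F>"
    with F have "E \<in> \<A>" unfolding A_filter_def by blast
    \<comment> \<open>Maximality: of \<open>E\<close> and \<open>X - E\<close> one already lies in
      \<open>Z_ideal X \<A> S P\<close>, and a larger filter containing \<open>E\<close> rules out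
      the second.\<close>
    moreover have "X - E \<notin> \<F>"
    proof
      assume "X - E \<in> \<F>"
      then have "E \<inter> (X - E) \<in> \<F>" using E F(1) unfolding A_filter_def by blast
      then show False using F(1) unfolding A_filter_def by simp
    qed
    ultimately show "E \<in> Z_ideal X \<A> S P"
      using F(2) prime_chi_iff[OF assms, of E] unfolding Z by blast
  qed
  with fil show ?thesis unfolding A_ultrafilter_def by blast
qed

section \<open>From ultrafilters back to prime ideals\<close>

text \<open>For an ultrafilter this is the kernel of reduction modulo \<open>\<U>\<close>, as for an
  ultrapower of the reals.\<close>

definition zero_ideal :: "'a set set \<Rightarrow> ('a \<Rightarrow> real) set" where
  "zero_ideal \<U> = {f \<in> S. {x \<in> X. f x = 0} \<in> \<U>}"

text \<open>The zero set of a product contains that of each factor, and the zero set of a sum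
  contains the intersection of the two, so the filter laws give an ideal; primality is
  \<open>A_ultrafilter_Un\<close>.\<close>

lemma primeideal_zero_ideal:
  assumes U: "A_ultrafilter \<A> \<U>"
  shows "primeideal (zero_ideal \<U>) R"
proof -
  have fil: "A_filter \<A> \<U>" using U by (simp add: A_ultrafilter_def)
  then have up: "F \<in> \<U>" if "E \<in> \<U>" "E \<subseteq> F" "F \<in> \<A>" for E F
    using that unfolding A_filter_def by blast
  have int: "E \<inter> F \<in> \<U>" if "E \<in> \<U>" "F \<in> \<U>" for E F
    using fil that unfolding A_filter_def by blast
  have emp: "{} \<notin> \<U>" using fil unfolding A_filter_def by blast
  have XU: "X \<in> \<U>"
    using fil up sets_into_space unfolding A_filter_def by (metis all_not_in_conv subsetD top)
  have mult: "f \<otimes>\<^bsub>R\<^esub> g \<in> zero_ideal \<U>" if f: "f \<in> zero_ideal \<U>" and g: "g \<in> carrier R" for f g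
  proof -
    have fg: "f \<otimes>\<^bsub>R\<^esub> g \<in> S" using f g R.m_closed[of f g] by (simp add: zero_ideal_def)
    have "{x \<in> X. (f \<otimes>\<^bsub>R\<^esub> g) x = 0} \<in> \<U>"
      by (rule up[of "{x \<in> X. f x = 0}"])
        (use f zero_set_sets[OF fg] in \<open>auto simp: zero_ideal_def\<close>)
    with fg show ?thesis by (simp add: zero_ideal_def)
  qed
  have add: "f \<oplus>\<^bsub>R\<^esub> g \<in> zero_ideal \<U>" if f: "f \<in> zero_ideal \<U>" and g: "g \<in> zero_ideal \<U>" for f g
  proof -
    have fg: "f \<oplus>\<^bsub>R\<^esub> g \<in> S" using f g R.a_closed[of f g] by (simp add: zero_ideal_def)
    have "{x \<in> X. (f \<oplus>\<^bsub>R\<^esub> g) x = 0} \<in> \<U>"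
      by (rule up[of "{x \<in> X. f x = 0} \<inter> {x \<in> X. g x = 0}"])
        (use f g int zero_set_sets[OF fg] in \<open>auto simp: zero_ideal_def\<close>)
    with fg show ?thesis by (simp add: zero_ideal_def)
  qed
  \<comment> \<open>Negation is multiplication by -1, so \<open>mult\<close> covers it without a
    pointwise formula for \<ominus>.\<close>
  have neg: "\<ominus>\<^bsub>R\<^esub> f \<in> zero_ideal \<U>" if f: "f \<in> zero_ideal \<U>" for f
  proof -
    have fS: "f \<in> carrier R" using f by (simp add: zero_ideal_def)
    have "f \<otimes>\<^bsub>R\<^esub> (\<ominus>\<^bsub>R\<^esub> \<one>\<^bsub>R\<^esub>) = \<ominus>\<^bsub>R\<^esub> f"
      using fS R.r_minus[of f "\<one>\<^bsub>R\<^esub>"] R.r_one[of f] R.one_closed by presburger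
    then show ?thesis using mult[OF f, of "\<ominus>\<^bsub>R\<^esub> \<one>\<^bsub>R\<^esub>"] R.a_inv_closed[OF R.one_closed] by metis
  qed
  have zero: "\<zero>\<^bsub>R\<^esub> \<in> zero_ideal \<U>"
    using R.zero_closed XU by (auto simp: zero_ideal_def)
  show ?thesis
  proof (rule primeidealI2)
    show "additive_subgroup (zero_ideal \<U>) R"
    proof (rule additive_subgroup.intro, rule R.add.subgroupI)
      show "zero_ideal \<U> \<subseteq> carrier R" by (auto simp: zero_ideal_def)
      show "zero_ideal \<U> \<noteq> {}" using zero by blast
    qed (use neg add in \<open>simp_all add: a_inv_def\<close>)
    show "carrier R \<noteq> zero_ideal \<U>"
    proof -
      have "{x \<in> X. \<one>\<^bsub>R\<^esub> x = 0} = {}" by auto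
      with emp have "\<one>\<^bsub>R\<^esub> \<notin> zero_ideal \<U>" unfolding zero_ideal_def by auto
      with R.one_closed show ?thesis by blast
    qed
    fix f g assume f: "f \<in> carrier R" and g: "g \<in> carrier R" and "f \<otimes>\<^bsub>R\<^esub> g \<in> zero_ideal \<U>"
    then have "{x \<in> X. (f \<otimes>\<^bsub>R\<^esub> g) x = 0} \<in> \<U>" unfolding zero_ideal_def by blast
    moreover have "{x \<in> X. (f \<otimes>\<^bsub>R\<^esub> g) x = 0} = {x \<in> X. f x = 0} \<union> {x \<in> X. g x = 0}" by auto
    ultimately show "f \<in> zero_ideal \<U> \<or> g \<in> zero_ideal \<U>"
      using A_ultrafilter_Un[OF sigma_algebra_axioms U] f g zero_set_sets
      by (simp add: zero_ideal_def)
  next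
    fix f g assume "f \<in> zero_ideal \<U>" "g \<in> carrier R"
    moreover from this have "g \<otimes>\<^bsub>R\<^esub> f = f \<otimes>\<^bsub>R\<^esub> g"
      by (intro R.m_comm) (simp_all add: zero_ideal_def)
    ultimately show "f \<otimes>\<^bsub>R\<^esub> g \<in> zero_ideal \<U>" "g \<otimes>\<^bsub>R\<^esub> f \<in> zero_ideal \<U>"
      using mult[of f g] by metis+
  qed (rule R.is_cring)
qed

text \<open>Provides one prime ideal below all maximal ideals that have the same image under
  \<open>Z_ideal\<close>.\<close>

lemma zero_ideal_Z_ideal_subset:
  assumes "primeideal P R"
  shows "zero_ideal (Z_ideal X \<A> S P) \<subseteq> P"
proof
  interpret P: primeideal P R by fact
  fix f assume "f \<in> zero_ideal (Z_ideal X \<A> S P)"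
  then have f: "f \<in> S" and "{x \<in> X. f x = 0} \<in> Z_ideal X \<A> S P"
    by (auto simp: zero_ideal_def)
  then have "chi X (X - {x \<in> X. f x = 0}) \<in> P"
    using Z_ideal_iff_chi_compl[OF P.is_ideal] by blast
  then have "f \<otimes>\<^bsub>R\<^esub> chi X (X - {x \<in> X. f x = 0}) \<in> P"
    using f by (intro P.I_l_closed) simp_all
  \<comment> \<open>Both sides are \<open>undefined\<close> outside \<open>X\<close>, so only points
    of \<open>X\<close> have to be compared.\<close>
  also have "f \<otimes>\<^bsub>R\<^esub> chi X (X - {x \<in> X. f x = 0}) = f"
    using f S_subset by (intro extensionalityI[of _ X]) (auto simp: chi_def indicator_def)
  finally show "f \<in> P" .
qed

text \<open>The zero set of \<open>chi X (X - E)\<close> is \<open>E\<close> itself.\<close>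

lemma Z_ideal_zero_ideal:
  assumes U: "A_ultrafilter \<A> \<U>"
  shows "Z_ideal X \<A> S (zero_ideal \<U>) = \<U>"
proof -
  have sub: "\<U> \<subseteq> \<A>" using U by (simp add: A_ultrafilter_def A_filter_def)
  have "chi X (X - E) \<in> zero_ideal \<U> \<longleftrightarrow> E \<in> \<U>" if "E \<in> \<A>" for E
  proof -
    have "{x \<in> X. chi X (X - E) x = 0} = E"
      using sets_into_space[OF that] by (auto simp: chi_def indicator_def)
    then show ?thesis using that by (simp add: zero_ideal_def chi_closed compl_sets)
  qed
  then show ?thesis
    using sub Z_ideal_iff_chi_compl[OF primeideal.axioms(1)[OF primeideal_zero_ideal[OF U]]]
    by blast
qed

section \<open>Surjectivity, and injectivity as the Gelfand property\<close>

lemma prime_subset_maximal: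
  assumes "primeideal P R"
  obtains M where "maximalideal M R" "P \<subseteq> M"
  using assms R.ex_maximalideal[of P] ideal.one_imp_carrier primeideal.I_notcarr
  by (metis primeideal.axioms(1))

text \<open>For surjectivity, enlarge \<open>zero_ideal \<U>\<close> to a maximal ideal; the image
  stays \<open>\<U>\<close> because it is constant along inclusions of primes.\<close>

lemma Z_ideal_image_max_ideals:
  "Z_ideal X \<A> S ` max_ideals R = {\<U>. A_ultrafilter \<A> \<U>}"
proof
  show "Z_ideal X \<A> S ` max_ideals R \<subseteq> {\<U>. A_ultrafilter \<A> \<U>}"
    using A_ultrafilter_Z_ideal R.maximalideal_prime by (auto simp: max_ideals_def)
  show "{\<U>. A_ultrafilter \<A> \<U>} \<subseteq> Z_ideal X \<A> S ` max_ideals R"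
  proof
    fix \<U> assume "\<U> \<in> {\<U>. A_ultrafilter \<A> \<U>}"
    then have U: "A_ultrafilter \<A> \<U>" by simp
    obtain M where M: "maximalideal M R" "zero_ideal \<U> \<subseteq> M"
      using primeideal_zero_ideal[OF U] by (rule prime_subset_maximal)
    then have "Z_ideal X \<A> S M = \<U>"
      using Z_ideal_prime_mono_eq[OF primeideal_zero_ideal[OF U] R.maximalideal_prime]
        Z_ideal_zero_ideal[OF U] by simp
    with M show "\<U> \<in> Z_ideal X \<A> S ` max_ideals R" by (auto simp: max_ideals_def)
  qed
qed

text \<open>Two maximal ideals have the same image exactly when some prime ideal lies below
  both.\<close>

lemma gelfand_iff_inj_on: "gelfand R \<longleftrightarrow> inj_on (Z_ideal X \<A> S) (max_ideals R)"
proof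
  assume G: "gelfand R"
  show "inj_on (Z_ideal X \<A> S) (max_ideals R)"
  proof (rule inj_onI)
    fix M N assume MN: "M \<in> max_ideals R" "N \<in> max_ideals R" "Z_ideal X \<A> S M = Z_ideal X \<A> S N"
    then have max: "maximalideal M R" "maximalideal N R" by (auto simp: max_ideals_def)
    then have prime: "primeideal M R" "primeideal N R" by (auto intro: R.maximalideal_prime)
    let ?P = "zero_ideal (Z_ideal X \<A> S M)"
    have "?P \<subseteq> M" "?P \<subseteq> N"
      using prime[THEN zero_ideal_Z_ideal_subset] MN(3) by simp_all
    moreover have "primeideal ?P R"
      using prime(1) by (intro primeideal_zero_ideal A_ultrafilter_Z_ideal)
    ultimately show "M = N" using G max unfolding gelfand_def by blast
  qed
next
  assume inj: "inj_on (Z_ideal X \<A> S) (max_ideals R)"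
  have "\<exists>!M. maximalideal M R \<and> P \<subseteq> M" if P: "primeideal P R" for P
  proof (rule ex_ex1I)
    show "\<exists>M. maximalideal M R \<and> P \<subseteq> M" by (rule prime_subset_maximal[OF P]) blast
    fix M N assume MN: "maximalideal M R \<and> P \<subseteq> M" "maximalideal N R \<and> P \<subseteq> N"
    then have "Z_ideal X \<A> S M = Z_ideal X \<A> S N"
      using Z_ideal_prime_mono_eq[OF P] R.maximalideal_prime by metis
    then show "M = N" using inj MN by (auto simp: max_ideals_def dest: inj_onD)
  qed
  then show "gelfand R" using R.is_cring unfolding gelfand_def by blast
qed

section \<open>Comparison of the topologies\<close>

lemma subset_Z_ideal_iff:
  assumes "\<E> \<subseteq> \<A>" "M \<in> max_ideals R"
  shows "\<E> \<subseteq> Z_ideal X \<A> S M \<longleftrightarrow> (\<forall>E\<in>(\<lambda>E. X - E) ` \<E>. chi X E \<in> M)"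
  using assms Z_ideal_iff_chi_compl[of M] by (auto simp: max_ideals_def dest: maximalideal.axioms(1))

text \<open>Complementation permutes \<open>\<A>\<close> and exchanges the two descriptions of basic
  closed sets. Thus the closed sets of \<open>tau_chi\<close> are the preimages of the Stone-closed
  sets.\<close>

lemma closedin_tau_chi_iff:
  "closedin (tau_chi X \<A> S) K \<longleftrightarrow>
    (\<exists>\<E>\<subseteq>\<A>. K = {M \<in> max_ideals R. \<E> \<subseteq> Z_ideal X \<A> S M})" (is "_ \<longleftrightarrow> ?R")
proof
  assume "closedin (tau_chi X \<A> S) K"
  then obtain \<E> where E: "\<E> \<subseteq> \<A>" "K = {M \<in> max_ideals R. \<forall>E\<in>\<E>. chi X E \<in> M}"
    unfolding tau_chi_base[OF sigma_algebra_axioms chi_ring] by blast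
  let ?F = "(\<lambda>E. X - E) ` \<E>"
  have "X - (X - E) = E" if "E \<in> \<E>" for E
    using that E(1) sets_into_space by blast
  then have "(\<lambda>E. X - E) ` ?F = \<E>"
    unfolding image_image by simp
  moreover have "?F \<subseteq> \<A>" using E(1) by auto
  ultimately have "K = {M \<in> max_ideals R. ?F \<subseteq> Z_ideal X \<A> S M}"
    unfolding E(2) using subset_Z_ideal_iff[of ?F] by (intro Collect_cong conj_cong refl) metis
  with \<open>?F \<subseteq> \<A>\<close> show ?R by blast
next
  assume ?R
  then obtain \<E> where E: "\<E> \<subseteq> \<A>" "K = {M \<in> max_ideals R. \<E> \<subseteq> Z_ideal X \<A> S M}" by blast
  then have "K = {M \<in> max_ideals R. \<forall>E\<in>(\<lambda>E. X - E) ` \<E>. chi X E \<in> M}"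
    using subset_Z_ideal_iff[of \<E>] by auto
  moreover have "(\<lambda>E. X - E) ` \<E> \<subseteq> \<A>" using E(1) by auto
  ultimately show "closedin (tau_chi X \<A> S) K"
    unfolding tau_chi_base[OF sigma_algebra_axioms chi_ring] by blast
qed

lemma homeomorphic_map_Z_ideal_iff_inj_on:
  "homeomorphic_map (tau_chi X \<A> S) (stone_topology \<A>) (Z_ideal X \<A> S) \<longleftrightarrow>
    inj_on (Z_ideal X \<A> S) (max_ideals R)"
proof -
  let ?Z = "Z_ideal X \<A> S"
  note top = tau_chi_base(1)[OF sigma_algebra_axioms chi_ring]
    and stone = stone_topology_base[OF sigma_algebra_axioms]
  have "continuous_map (tau_chi X \<A> S) (stone_topology \<A>) ?Z"
    unfolding continuous_map_closedin top
  proof (intro conjI ballI allI impI)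
    show "?Z \<in> max_ideals R \<rightarrow> topspace (stone_topology \<A>)"
      using Z_ideal_image_max_ideals stone(1) by blast
    fix K assume "closedin (stone_topology \<A>) K"
    then obtain \<E> where E: "\<E> \<subseteq> \<A>" "K = {\<U>. A_ultrafilter \<A> \<U> \<and> \<E> \<subseteq> \<U>}"
      unfolding stone by blast
    then have "{M \<in> max_ideals R. ?Z M \<in> K} = {M \<in> max_ideals R. \<E> \<subseteq> ?Z M}"
      using Z_ideal_image_max_ideals by blast
    with E(1) show "closedin (tau_chi X \<A> S) {M \<in> max_ideals R. ?Z M \<in> K}"
      unfolding closedin_tau_chi_iff by blast
  qed
  \<comment> \<open>Membership of \<open>M\<close> in a closed \<open>K\<close> depends only on
    \<open>?Z M\<close>, so with surjectivity \<open>?Z\<close> maps \<open>K\<close> onto the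
    Stone-closed set of which it is the preimage; injectivity does not enter.\<close>
  moreover have "closed_map (tau_chi X \<A> S) (stone_topology \<A>) ?Z"
    unfolding closed_map_def
  proof (intro allI impI)
    fix K assume "closedin (tau_chi X \<A> S) K"
    then obtain \<E> where E: "\<E> \<subseteq> \<A>" "K = {M \<in> max_ideals R. \<E> \<subseteq> ?Z M}"
      unfolding closedin_tau_chi_iff by blast
    then have "?Z ` K = {\<U>. \<U> \<in> ?Z ` max_ideals R \<and> \<E> \<subseteq> \<U>}" by blast
    with E(1) show "closedin (stone_topology \<A>) (?Z ` K)"
      unfolding stone Z_ideal_image_max_ideals by auto
  qed
  ultimately show ?thesis
    using Z_ideal_image_max_ideals unfolding homeomorphic_eq_everything_map
    by (metis top stone(1) bijective_closed_imp_homeomorphic_map homeomorphic_eq_everything_map)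
qed

end

theorem corollary3p6:
  fixes X :: "'a set" and \<A> :: "'a set set" and S :: "('a \<Rightarrow> real) set"
  assumes "sigma_algebra X \<A>" and "X \<noteq> {}"
    and "chi_ring X \<A> S"
  shows "gelfand (fun_ring_on X \<A> S) \<longleftrightarrow>
    homeomorphic_map (tau_chi X \<A> S) (stone_topology \<A>) (Z_ideal X \<A> S)"
proof -
  interpret chi_ring_space X \<A> S
    using assms(1,3) by (intro chi_ring_space.intro chi_ring_space_axioms.intro)
  show ?thesis
    by (simp only: gelfand_iff_inj_on homeomorphic_map_Z_ideal_iff_inj_on)
qed

end
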